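(* Let $n\ge 2$. The index $RIC$ is bounded from above on the set $M_R$ of reciprocal matrices of order $n$: there exists $K\in\mathbb{R}$ such that $RIC(A)\le K$ for all $A\in M_R$.
   Context: $M_R$ is the set of all real $n\times n$ matrices $A=(a_{ij})$ with $a_{ij}>0$ for all $i,j$ and $a_{ij}=1/a_{ji}$ for all $i,j$ (reciprocal matrices). For $A\in M_R$ let $r_i=(a_{i1},\dots,a_{in})$ be its $i$-th row, let $\varphi_{ij}$ be the angle between $r_i$ and $r_j$, so $\cos\varphi_{ij}=\frac{r_i\cdot r_j}{|r_i|\,|r_j|}$ (Euclidean dot product and norm). The row inconsistency index is $RIC(A)=1-\frac{2\sum_{i=1}^{n-1}\sum_{j=i+1}^{n}\cos\varphi_{ij}}{n(n-1)}$. *)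

theory Defs
  imports "HOL-Analysis.Analysis"
begin

(* Matrices of order n have type real^'n^'n with n = CARD('n); the linear order on 'n
   is used only to sum over pairs of indices i < j. *)

definition reciprocal_matrices :: "(real^'n^'n) set" where
  "reciprocal_matrices = {A. (\<forall>i j. A $ i $ j > 0) \<and> (\<forall>i j. A $ i $ j = 1 / A $ j $ i)}"

(* For x = 0 or y = 0 this takes the junk value arccos 0; rows of a matrix with positive
   entries are never 0. *)
definition vec_angle :: "'a::real_inner \<Rightarrow> 'a \<Rightarrow> real" where
  "vec_angle x y = arccos ((x \<bullet> y) / (norm x * norm y))"

(* The inner sum is empty for the greatest index i, so i effectively ranges over all
   indices but the last. *)
definition RIC :: "real^'n::{finite,linorder}^'n::{finite,linorder} \<Rightarrow> real" where
  "RIC A = 1 - 2 * (\<Sum>i\<in>UNIV. \<Sum>j\<in>{i<..}. cos (vec_angle (row i A) (row j A)))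
                 / (real CARD('n) * (real CARD('n) - 1))"

end

theory Submission
  imports Defs
begin

text \<open>Rows of a reciprocal matrix have positive entries, so any two have a nonnegative dot
  product and the cosine of their angle is nonnegative. \<open>RIC\<close> subtracts a nonnegative
  multiple of the sum of these cosines from 1, so \<open>K = 1\<close> works.\<close>

text \<open>By Cauchy-Schwarz the quotient lies in [-1, 1], where \<open>cos\<close> undoes
  \<open>arccos\<close>; for a zero vector both sides are 0.\<close>

lemma cos_vec_angle: "cos (vec_angle x y) = (x \<bullet> y) / (norm x * norm y)"
proof -
  have "\<bar>(x \<bullet> y) / (norm x * norm y)\<bar> \<le> 1"
    using Cauchy_Schwarz_ineq2[of x y] by (auto simp: abs_mult divide_le_eq_1 zero_less_mult_iff)
  then show ?thesis
    by (simp add: vec_angle_def cos_arccos_abs)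
qed

lemma RIC_le_1:
  fixes A :: "real^'n::{finite,linorder}^'n::{finite,linorder}"
  assumes "\<And>i j. A $ i $ j \<ge> 0"
  shows "RIC A \<le> 1"
proof -
  have "cos (vec_angle (row i A) (row j A)) \<ge> 0" for i j
    unfolding cos_vec_angle using assms
    by (intro divide_nonneg_nonneg) (auto simp: inner_vec_def row_def intro!: sum_nonneg)
  then show ?thesis
    \<comment> \<open>\<open>Suc_leI\<close> yields \<open>CARD('n)\<close> \<ge> 1, so the
      denominator is nonnegative.\<close>
    unfolding RIC_def by (simp add: sum_nonneg Suc_leI)
qed

theorem proposition11:
  assumes "CARD('n::{finite,linorder}) \<ge> 2"
  shows "\<exists>K::real. \<forall>A \<in> (reciprocal_matrices :: (real^'n::{finite,linorder}^'n::{finite,linorder}) set). RIC A \<le> K"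
proof (intro exI ballI)
  fix A :: "real^'n::{finite,linorder}^'n::{finite,linorder}"
  assume "A \<in> reciprocal_matrices"
  then have "A $ i $ j \<ge> 0" for i j
    unfolding reciprocal_matrices_def by (blast intro: less_imp_le)
  then show "RIC A \<le> 1"
    by (rule RIC_le_1)
qed

end
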